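(* Fix $P\in\mathcal{P}_d$. Then: (i) $z\mapsto ED(z,P)$ is uniformly continuous over $\mathbb{R}^d$; (ii) for $d=1$, $z\mapsto ED(z,P)$ is left- and right-differentiable over $\mathbb{R}$; (iii) for $d\geq2$, if $P$ is smooth in a neighbourhood $\mathcal{N}$ of $z_0\in\mathbb{R}^d$ (meaning that for any $z\in\mathcal{N}$, any hyperplane containing $z$ has $P$-probability zero), then $z\mapsto ED(z,P)$ admits directional derivatives at $z_0$ in all directions.
   Context: A prime denotes transposition, $\mathbb{I}[A]$ is the indicator of $A$, and $\mathcal{S}^{d-1}=\{z\in\mathbb{R}^d:\|z\|=1\}$. $\mathcal{P}_d$ is the collection of probability measures over $\mathbb{R}^d$ that do not give probability one to any hyperplane of $\mathbb{R}^d$ (for $d=1$, to any singleton) and that have finite first-order moments. For $P\in\mathcal{P}_d$ and $z\in\mathbb{R}^d$, the expectile depth of $z$ with respect to $P$ is $$ED(z,P)=\inf_{u\in\mathcal{S}^{d-1}}\frac{\mathrm{E}[|u'(Z-z)|\,\mathbb{I}[u'(Z-z)\leq0]]}{\mathrm{E}[|u'(Z-z)|]},\qquad Z\sim P.$$ The directional derivative of a function $f$ at $z_0$ in direction $v\in\mathcal{S}^{d-1}$ is the one-sided limit $\lim_{h\downarrow0}(f(z_0+hv)-f(z_0))/h$. *)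

theory Defs
  imports "HOL-Probability.Probability"
begin

definition hyperplane :: "'a::euclidean_space set \<Rightarrow> bool" where
  "hyperplane H \<longleftrightarrow> (\<exists>a b. a \<noteq> 0 \<and> H = {x. a \<bullet> x = b})"

text \<open>The class of measures for which expectile depth is considered. If the dimension is 1,
  hyperplanes are exactly the singletons.\<close>

definition expectile_class :: "'a::euclidean_space measure set" where
  "expectile_class = {P. prob_space P \<and> sets P = sets borel \<and>
     (\<forall>H. hyperplane H \<longrightarrow> measure P H \<noteq> 1) \<and> integrable P (\<lambda>x. x)}"

text \<open>The denominator is positive for every measure in \<^const>\<open>expectile_class\<close>, and the infimum
  is over a nonempty set of nonnegative reals.\<close>

definition expectile_depth :: "'a::euclidean_space \<Rightarrow> 'a measure \<Rightarrow> real" where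
  "expectile_depth z P =
     (INF u\<in>sphere 0 1.
        (\<integral>x. \<bar>u \<bullet> (x - z)\<bar> * indicator {x. u \<bullet> (x - z) \<le> 0} x \<partial>P) /
        (\<integral>x. \<bar>u \<bullet> (x - z)\<bar> \<partial>P))"

definition smooth_measure_on :: "'a::euclidean_space measure \<Rightarrow> 'a set \<Rightarrow> bool" where
  "smooth_measure_on P N \<longleftrightarrow> (\<forall>z\<in>N. \<forall>H. hyperplane H \<and> z \<in> H \<longrightarrow> measure P H = 0)"

definition has_directional_derivative ::
    "('a::euclidean_space \<Rightarrow> real) \<Rightarrow> real \<Rightarrow> 'a \<Rightarrow> 'a \<Rightarrow> bool" where
  "has_directional_derivative f D z v \<longleftrightarrow>
     ((\<lambda>h. (f (z + h *\<^sub>R v) - f z) / h) \<longlongrightarrow> D) (at_right 0)"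

end

theory Submission
  imports Defs
begin

text \<open>
  Let \<open>L t u = E[max 0 (t - u \<bullet> Z)]\<close> and \<open>A t u = E \<bar>u \<bullet> Z - t\<bar>\<close>, so that the depth of \<open>z\<close> is the
  infimum over unit vectors \<open>u\<close> of \<open>L (u \<bullet> z) u / A (u \<bullet> z) u\<close>. Since \<open>A t u = 2 * L t u + u \<bullet> E[Z] - t\<close>,
  everything is controlled by \<open>L\<close>, which is 1-Lipschitz in \<open>t\<close>.

  Uniform continuity. No hyperplane carries full mass, so \<open>A\<close> is positive; it tends to infinity
  with \<open>\<bar>t\<bar>\<close>, uniformly in \<open>u\<close>, so by compactness \<open>A\<close> is bounded below by some \<open>c > 0\<close> on all of
  \<open>\<real>\<close> times the sphere (\<open>abs_dev_lower_bound\<close>). Hence all the ratios are Lipschitz in \<open>z\<close> with the common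
  constant \<open>2 / c\<close>, and so is their infimum.

  Directional derivatives. An argument of Danskin type (\<open>has_right_derivative_INF\<close>) differentiates an
  infimum over a compact set: it suffices that the difference quotients \<open>q h u\<close> of the ratio along
  \<open>z + h v\<close> extend to a function that is jointly continuous in \<open>(h, u)\<close> up to \<open>h = 0\<close>. By dominated
  convergence, this holds as soon as every unit vector \<open>u\<close> either has a null hyperplane through \<open>z\<close>
  orthogonal to it, or is an isolated point of the sphere
  (\<open>continuous_on_integral_neg_slope\<close>). The first alternative is smoothness of the measure; the
  second one holds in dimension one, where the sphere is finite. So the one-dimensional
  statement and the smooth multivariate one are two instances of
  \<open>directional_derivative_expectile_depth\<close>.
\<close>

section \<open>One-sided derivatives of infima over a compact set\<close>

text \<open>
  The derivative is the minimum of \<open>q 0\<close> over the minimisers of \<open>g\<close>. A minimiser \<open>w\<close> attaining it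
  gives the upper bound. For the lower bound, points with \<open>q 0 u\<close> close to or above \<open>q 0 w\<close> have a large
  enough slope by uniform continuity of \<open>q\<close>; the remaining points form a compact set free of minimisers.
\<close>

lemma has_right_derivative_INF:
  fixes g :: "'u::metric_space \<Rightarrow> real" and q :: "real \<Rightarrow> 'u \<Rightarrow> real"
  assumes K: "compact K" "K \<noteq> {}"
    and g: "continuous_on K g"
    and q: "continuous_on ({0..1} \<times> K) (\<lambda>(h, u). q h u)"
    and m: "\<And>h. 0 \<le> h \<Longrightarrow> h \<le> 1 \<Longrightarrow> m h = (INF u\<in>K. g u + h * q h u)"
  obtains D where "((\<lambda>h. (m h - m 0) / h) \<longlongrightarrow> D) (at_right 0)"
proof -
  obtain u0 where u0: "u0 \<in> K" "\<And>u. u \<in> K \<Longrightarrow> g u0 \<le> g u"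
    using continuous_attains_inf[OF K g] by auto
  have m0: "m 0 = g u0"
    using m[of 0] u0 cInf_eq_minimum[of "g u0" "g ` K"] by auto
  have preimage: "compact (K \<inter> f -` S)" if "continuous_on K f" "closed S"
    for f :: "'u \<Rightarrow> real" and S
    using compact_Int_closed[OF K(1) continuous_closed_preimage[OF that(1) compact_imp_closed[OF K(1)] that(2)]]
    by simp
  define M where "M = K \<inter> g -` {g u0}"
  have "compact M"
    unfolding M_def by (intro preimage g) auto
  have "u0 \<in> M"
    using u0 by (auto simp: M_def)
  have q0: "continuous_on K (q 0)"
    by (rule continuous_on_compose2[OF q, of K "\<lambda>u. (0, u)", simplified])
       (auto intro!: continuous_intros)
  then obtain w where w: "w \<in> M" "\<And>u. u \<in> M \<Longrightarrow> q 0 w \<le> q 0 u"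
    using continuous_attains_inf[OF \<open>compact M\<close>, of "q 0"] \<open>u0 \<in> M\<close>
      continuous_on_subset[OF q0, of M] by (auto simp: M_def)
  have cK: "compact ({0..1::real} \<times> K)"
    using K by (intro compact_Times) auto
  have uc: "uniformly_continuous_on ({0..1} \<times> K) (\<lambda>(h, u). q h u)"
    by (rule compact_uniformly_continuous[OF q cK])
  obtain B where B: "\<And>h u. h \<in> {0..1} \<Longrightarrow> u \<in> K \<Longrightarrow> \<bar>q h u\<bar> \<le> B"
    using compact_imp_bounded[OF compact_continuous_image[OF q cK]]
    by (force simp: bounded_iff)
  have bdd: "bdd_below ((\<lambda>u. g u + h * q h u) ` K)" if "h \<in> {0..1}" for h
  proof (rule bdd_belowI2)
    fix u assume u: "u \<in> K"
    have "\<bar>h * q h u\<bar> \<le> 1 * B"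
      unfolding abs_mult using that B[OF that u] by (intro mult_mono) auto
    thus "g u0 - B \<le> g u + h * q h u"
      using u0(2)[OF u] by linarith
  qed
  have "((\<lambda>h. (m h - m 0) / h) \<longlongrightarrow> q 0 w) (at_right 0)"
  proof (rule tendstoI)
    fix e :: real assume e: "e > 0"
    define e2 where "e2 = e / 4"
    have e2: "e2 > 0" using e by (simp add: e2_def)
    obtain d where d: "d > 0"
      "\<And>h u. h \<in> {0..1} \<Longrightarrow> u \<in> K \<Longrightarrow> h < d \<Longrightarrow> \<bar>q h u - q 0 u\<bar> < e2"
    proof -
      from uc e2 obtain d where "d > 0" and d: "\<And>x x'. x \<in> {0..1} \<times> K \<Longrightarrow> x' \<in> {0..1} \<times> K \<Longrightarrow>
         dist x' x < d \<Longrightarrow> dist (case x' of (h, u) \<Rightarrow> q h u) (case x of (h, u) \<Rightarrow> q h u) < e2"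
        unfolding uniformly_continuous_on_def by metis
      show thesis
      proof (rule that[OF \<open>d > 0\<close>])
        fix h u assume "h \<in> {0..1::real}" "u \<in> K" "h < d"
        thus "\<bar>q h u - q 0 u\<bar> < e2"
          using d[of "(0, u)" "(h, u)"] by (auto simp: dist_Pair_Pair dist_real_def)
      qed
    qed
    define C where "C = K \<inter> q 0 -` {..q 0 w - e2}"
    have "compact C"
      unfolding C_def by (intro preimage q0) auto
    \<comment> \<open>\<open>C\<close> contains no minimiser of \<open>g\<close>, so compactness yields a gap, which outweighs the bounded
        slopes once \<open>h\<close> is small.\<close>
    obtain eta where eta: "eta > 0" "\<And>u. u \<in> C \<Longrightarrow> g u \<ge> g u0 + eta"
    proof (cases "C = {}")
      case True thus thesis using that[of 1] by auto
    next
      case False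
      have "continuous_on C g"
        using g by (rule continuous_on_subset) (auto simp: C_def)
      then obtain c where c: "c \<in> C" "\<And>u. u \<in> C \<Longrightarrow> g c \<le> g u"
        using continuous_attains_inf[OF \<open>compact C\<close> False] by blast
      have "c \<notin> M" using w(2)[of c] c(1) e2 by (auto simp: C_def)
      hence "g c > g u0" using u0(2)[of c] c(1) by (auto simp: C_def M_def)
      thus thesis using that[of "g c - g u0"] c by auto
    qed
    have Bpos: "B \<ge> 0" using B[of 0 u0] u0 by force
    define h0 where "h0 = min (min 1 d) (eta / (2 * B + 1))"
    have h0: "h0 > 0" using d(1) eta(1) Bpos by (simp add: h0_def)
    have key: "dist ((m h - m 0) / h) (q 0 w) < e" if h: "0 < h" "h < h0" for h
    proof -
      have h1: "h \<in> {0..1}" "h < d" using h by (auto simp: h0_def)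
      have "m h \<le> g w + h * q h w"
        using w(1) m[of h] h1 cINF_lower[OF bdd[OF h1(1)], of w] by (auto simp: M_def)
      also have "g w = m 0" using w(1) m0 by (auto simp: M_def)
      finally have "(m h - m 0) / h \<le> q h w"
        using h by (simp add: divide_simps mult.commute)
      also have "q h w < q 0 w + e2"
        using d(2)[OF h1(1) _ h1(2), of w] w(1) by (auto simp: M_def)
      finally have up: "(m h - m 0) / h < q 0 w + e2" .
      have "m 0 + h * (q 0 w - 2 * e2) \<le> m h"
      proof -
        have "g u0 + h * (q 0 w - 2 * e2) \<le> g u + h * q h u" if u: "u \<in> K" for u
        proof (cases "u \<in> C")
          case False
          hence "q 0 w - 2 * e2 \<le> q h u"
            using d(2)[OF h1(1) u h1(2)] u by (auto simp: C_def)
          hence "h * (q 0 w - 2 * e2) \<le> h * q h u" using h by simp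
          thus ?thesis using u0(2)[OF u] by linarith
        next
          case True
          have "q 0 w - 2 * e2 - q h u \<le> 2 * B"
            using B[of 0 w] B[OF h1(1) u] w(1) e2 by (auto simp: M_def)
          hence "h * (q 0 w - 2 * e2 - q h u) \<le> h * (2 * B + 1)"
            using h by (intro mult_left_mono) auto
          also have "\<dots> \<le> eta"
            using h Bpos by (simp add: h0_def field_simps)
          finally show ?thesis using eta(2)[OF True] by (simp add: algebra_simps)
        qed
        thus ?thesis
          using m[of h] h1 m0 K by (auto intro!: cINF_greatest)
      qed
      hence "q 0 w - 2 * e2 \<le> (m h - m 0) / h"
        using h by (simp add: divide_simps mult.commute)
      thus ?thesis using up e2 unfolding dist_real_def e2_def by linarith
    qed
    show "\<forall>\<^sub>F h in at_right 0. dist ((m h - m 0) / h) (q 0 w) < e"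
      unfolding eventually_at_right_field using h0 key by blast
  qed
  thus thesis by (rule that)
qed

section \<open>Difference quotients of the negative part\<close>

text \<open>
  The difference quotient at \<open>0\<close> of \<open>h \<mapsto> max 0 (h * c - y)\<close>; its value at \<open>h = 0\<close> is the right derivative,
  which takes a separate form on the kink \<open>y = 0\<close>.
\<close>

definition neg_slope :: "real \<Rightarrow> real \<Rightarrow> real \<Rightarrow> real" where
  "neg_slope h c y =
     (if h = 0 then if y < 0 then c else if y = 0 then max 0 c else 0
      else (max 0 (h * c - y) - max 0 (- y)) / h)"

lemma neg_slope_eq: "max 0 (h * c - y) = max 0 (- y) + h * neg_slope h c y"
  by (simp add: neg_slope_def)

lemma abs_neg_slope_le: "\<bar>neg_slope h c y\<bar> \<le> \<bar>c\<bar>"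
proof (cases "h = 0")
  case False
  have "\<bar>max 0 (h * c - y) - max 0 (- y)\<bar> \<le> \<bar>h * c\<bar>" by linarith
  thus ?thesis using False by (simp add: neg_slope_def abs_mult divide_simps mult.commute)
qed (auto simp: neg_slope_def)

lemma borel_measurable_neg_slope [measurable]:
  "neg_slope h c \<in> borel_measurable borel"
  unfolding neg_slope_def by measurable

text \<open>
  The only discontinuity at \<open>h = 0\<close> comes from \<open>y\<close> crossing the kink. For \<open>y\<close> fixed at \<open>0\<close>, positive
  homogeneity makes the quotient equal to \<open>max 0 c\<close> for every \<open>h \<ge> 0\<close>, so there is no jump.
\<close>

lemma tendsto_neg_slope:
  assumes h: "(h \<longlongrightarrow> h0) F" "\<forall>\<^sub>F n in F. 0 \<le> h n" "0 \<le> h0"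
    and c: "(c \<longlongrightarrow> c0) F" and y: "(y \<longlongrightarrow> y0) F"
    and yz: "h0 = 0 \<Longrightarrow> y0 = 0 \<Longrightarrow> \<forall>\<^sub>F n in F. y n = 0"
  shows "((\<lambda>n. neg_slope (h n) (c n) (y n)) \<longlongrightarrow> neg_slope h0 c0 y0) F"
proof -
  have hcy: "((\<lambda>n. h n * c n - y n) \<longlongrightarrow> h0 * c0 - y0) F"
    by (intro tendsto_intros h c y)
  consider "h0 > 0" | "h0 = 0" "y0 < 0" | "h0 = 0" "y0 > 0" | "h0 = 0" "y0 = 0"
    using h(3) by linarith
  thus ?thesis
  proof cases
    case 1
    have "((\<lambda>n. (max 0 (h n * c n - y n) - max 0 (- y n)) / h n) \<longlongrightarrow>
            (max 0 (h0 * c0 - y0) - max 0 (- y0)) / h0) F"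
      using 1 by (intro tendsto_intros h c y) auto
    moreover have "\<forall>\<^sub>F n in F. h n > 0" using order_tendstoD(1)[OF h(1) 1] .
    hence "\<forall>\<^sub>F n in F. (max 0 (h n * c n - y n) - max 0 (- y n)) / h n
             = neg_slope (h n) (c n) (y n)"
      by eventually_elim (auto simp: neg_slope_def)
    ultimately show ?thesis using 1 by (simp add: neg_slope_def tendsto_cong)
  next
    case 2
    have "\<forall>\<^sub>F n in F. y n < 0" using order_tendstoD(2)[OF y 2(2)] .
    moreover have "\<forall>\<^sub>F n in F. h n * c n - y n > 0"
      using order_tendstoD(1)[OF hcy, of 0] 2 by auto
    ultimately have "\<forall>\<^sub>F n in F. c n = neg_slope (h n) (c n) (y n)"
      by eventually_elim (auto simp: neg_slope_def)
    thus ?thesis using c 2 by (simp add: neg_slope_def tendsto_cong)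
  next
    case 3
    have "\<forall>\<^sub>F n in F. y n > 0" using order_tendstoD(1)[OF y 3(2)] .
    moreover have "\<forall>\<^sub>F n in F. h n * c n - y n < 0"
      using order_tendstoD(2)[OF hcy, of 0] 3 by auto
    ultimately have "\<forall>\<^sub>F n in F. 0 = neg_slope (h n) (c n) (y n)"
      by eventually_elim (auto simp: neg_slope_def)
    thus ?thesis using 3 by (simp add: neg_slope_def tendsto_eventually eventually_mono)
  next
    case 4
    have "\<forall>\<^sub>F n in F. max 0 (c n) = neg_slope (h n) (c n) (y n)"
      using yz[OF 4] h(2)
      by eventually_elim (auto simp: neg_slope_def max_def divide_simps zero_le_mult_iff)
    moreover have "((\<lambda>n. max 0 (c n)) \<longlongrightarrow> max 0 c0) F"
      by (intro tendsto_intros c)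
    ultimately show ?thesis using 4 by (simp add: neg_slope_def tendsto_cong)
  qed
qed

section \<open>Projected deviations\<close>

definition lower_dev :: "'a::euclidean_space measure \<Rightarrow> real \<Rightarrow> 'a \<Rightarrow> real" where
  "lower_dev P t u = (\<integral>x. max 0 (t - u \<bullet> x) \<partial>P)"

definition abs_dev :: "'a::euclidean_space measure \<Rightarrow> real \<Rightarrow> 'a \<Rightarrow> real" where
  "abs_dev P t u = (\<integral>x. \<bar>u \<bullet> x - t\<bar> \<partial>P)"

lemma expectile_depth_eq_INF:
  "expectile_depth z P = (INF u\<in>sphere 0 1. lower_dev P (u \<bullet> z) u / abs_dev P (u \<bullet> z) u)"
proof -
  have "\<bar>u \<bullet> (x - z)\<bar> * indicator {x. u \<bullet> (x - z) \<le> 0} x = max 0 (u \<bullet> z - u \<bullet> x)" for u x :: 'a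
    by (auto simp: indicator_def inner_diff_right)
  thus ?thesis
    by (simp add: expectile_depth_def lower_dev_def abs_dev_def inner_diff_right)
qed

locale expectile_measure = prob_space P for P :: "'a::euclidean_space measure" +
  assumes sets_eq [measurable_cong]: "sets P = sets borel"
    and hyperplane_not_full: "hyperplane H \<Longrightarrow> measure P H \<noteq> 1"
    and integrable_id: "integrable P (\<lambda>x. x)"
begin

lemma integrable_inner [simp, intro]: "integrable P (\<lambda>x. u \<bullet> x)"
  using integrable_id by (rule integrable_inner_right[of u]) 

lemma integrable_lower_dev [simp, intro]: "integrable P (\<lambda>x. max 0 (t - u \<bullet> x))"
  by (intro integrable_max Bochner_Integration.integrable_diff) auto

lemma integrable_abs_dev [simp, intro]: "integrable P (\<lambda>x. \<bar>u \<bullet> x - t\<bar>)"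
  by (intro integrable_abs Bochner_Integration.integrable_diff) auto

lemma integral_inner: "(\<integral>x. u \<bullet> x \<partial>P) = u \<bullet> (\<integral>x. x \<partial>P)"
  using integrable_id by (intro integral_inner_right) auto

text \<open>This identity reduces the study of the ratio to that of its numerator.\<close>

lemma abs_dev_eq: "abs_dev P t u = 2 * lower_dev P t u + (u \<bullet> (\<integral>x. x \<partial>P) - t)"
proof -
  have "abs_dev P t u = (\<integral>x. 2 * max 0 (t - u \<bullet> x) + (u \<bullet> x - t) \<partial>P)"
    unfolding abs_dev_def by (intro Bochner_Integration.integral_cong) (auto simp: max_def)
  also have "\<dots> = 2 * lower_dev P t u + (u \<bullet> (\<integral>x. x \<partial>P) - t)"
    by (simp add: lower_dev_def integral_inner prob_space)
  finally show ?thesis .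
qed

lemma lower_dev_nonneg: "0 \<le> lower_dev P t u"
  unfolding lower_dev_def by (intro integral_nonneg_AE) auto

lemma lower_dev_le_abs_dev: "lower_dev P t u \<le> abs_dev P t u"
  unfolding lower_dev_def abs_dev_def by (intro integral_mono) auto

lemma lower_dev_diff_le:
  "\<bar>lower_dev P t u - lower_dev P s w\<bar> \<le> \<bar>t - s\<bar> + norm (u - w) * (\<integral>x. norm x \<partial>P)"
proof -
  have "\<bar>lower_dev P t u - lower_dev P s w\<bar> =
      \<bar>\<integral>x. max 0 (t - u \<bullet> x) - max 0 (s - w \<bullet> x) \<partial>P\<bar>"
    by (simp add: lower_dev_def)
  also have "\<dots> \<le> (\<integral>x. \<bar>max 0 (t - u \<bullet> x) - max 0 (s - w \<bullet> x)\<bar> \<partial>P)"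
    by (rule integral_abs_bound)
  also have "\<dots> \<le> (\<integral>x. \<bar>t - s\<bar> + norm (u - w) * norm x \<partial>P)"
  proof (intro integral_mono)
    fix x
    have "\<bar>u \<bullet> x - w \<bullet> x\<bar> \<le> norm (u - w) * norm x"
      by (metis Cauchy_Schwarz_ineq2 inner_diff_left)
    thus "\<bar>max 0 (t - u \<bullet> x) - max 0 (s - w \<bullet> x)\<bar> \<le> \<bar>t - s\<bar> + norm (u - w) * norm x"
      by linarith
  qed (auto intro!: integrable_id integrable_norm)
  also have "\<dots> = \<bar>t - s\<bar> + norm (u - w) * (\<integral>x. norm x \<partial>P)"
    using integrable_norm[OF integrable_id] by (simp add: prob_space)
  finally show ?thesis .
qed

lemma continuous_on_lower_dev: "continuous_on A (\<lambda>(t, u). lower_dev P t u)"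
proof -
  have "isCont (\<lambda>(t, u). lower_dev P t u) (s, w)" for s w
  proof -
    let ?b = "\<lambda>p. \<bar>fst p - s\<bar> + norm (snd p - w) * (\<integral>x. norm x \<partial>P)"
    have "(?b \<longlongrightarrow> ?b (s, w)) (at (s, w))"
      by (intro tendsto_intros)
    hence "(?b \<longlongrightarrow> 0) (at (s, w))"
      by simp
    moreover have "\<forall>p. norm (lower_dev P (fst p) (snd p) - lower_dev P s w) \<le> ?b p"
      unfolding real_norm_def by (intro allI lower_dev_diff_le)
    ultimately have "((\<lambda>p. lower_dev P (fst p) (snd p) - lower_dev P s w) \<longlongrightarrow> 0) (at (s, w))"
      by (metis (no_types, lifting) Lim_null_comparison always_eventually)
    hence "isCont (\<lambda>p. lower_dev P (fst p) (snd p)) (s, w)"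
      by (simp add: isCont_def LIM_zero_iff)
    thus ?thesis
      by (simp add: case_prod_unfold)
  qed
  thus ?thesis by (auto intro!: continuous_at_imp_continuous_on)
qed

lemma continuous_on_lower_dev' [continuous_intros]:
  assumes "continuous_on A f" "continuous_on A g"
  shows "continuous_on A (\<lambda>x. lower_dev P (f x) (g x))"
  using continuous_on_compose2[OF continuous_on_lower_dev[of UNIV] continuous_on_Pair[OF assms]]
  by simp

lemma continuous_on_abs_dev [continuous_intros]:
  assumes "continuous_on A f" "continuous_on A g"
  shows "continuous_on A (\<lambda>x. abs_dev P (f x) (g x))"
  unfolding abs_dev_eq by (intro continuous_intros assms)

lemma abs_dev_pos:
  assumes "u \<noteq> 0"
  shows "0 < abs_dev P t u"
proof -
  have "abs_dev P t u \<noteq> 0"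
  proof
    assume "abs_dev P t u = 0"
    hence "AE x in P. \<bar>u \<bullet> x - t\<bar> = 0"
      unfolding abs_dev_def by (subst (asm) integral_nonneg_eq_0_iff_AE) auto
    hence "AE x in P. x \<in> {x. u \<bullet> x = t}" by eventually_elim auto
    hence "prob {x. u \<bullet> x = t} = 1"
      by (subst prob_eq_1) (auto simp: sets_eq intro!: borel_closed closed_hyperplane)
    thus False
      using hyperplane_not_full[of "{x. u \<bullet> x = t}"] assms by (auto simp: hyperplane_def)
  qed
  moreover have "0 \<le> abs_dev P t u"
    unfolding abs_dev_def by (intro integral_nonneg_AE) auto
  ultimately show ?thesis by linarith
qed

text \<open>
  Treating \<open>t = u \<bullet> z\<close> as a variable independent of \<open>u\<close> is what makes the bound uniform in \<open>z\<close>: only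
  \<open>t\<close> is unbounded, and \<open>abs_dev P t u \<ge> \<bar>t\<bar> - E (norm Z)\<close> deals with large \<open>\<bar>t\<bar>\<close>, whereas \<open>z\<close> can
  escape to infinity orthogonally to \<open>u\<close>.
\<close>

lemma abs_dev_lower_bound:
  obtains c where "c > 0" "\<And>t u. norm u = 1 \<Longrightarrow> c \<le> abs_dev P t u"
proof -
  define R where "R = (\<integral>x. norm x \<partial>P) + 1"
  have R: "R > 0" unfolding R_def by (intro add_nonneg_pos integral_nonneg_AE) auto
  have far: "1 \<le> abs_dev P t u" if u: "norm u = 1" and t: "\<bar>t\<bar> \<ge> R" for t u
  proof -
    have "\<bar>t\<bar> - (\<integral>x. norm x \<partial>P) = (\<integral>x. \<bar>t\<bar> - norm x \<partial>P)"
      using integrable_norm[OF integrable_id] by (simp add: prob_space)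
    also have "\<dots> \<le> abs_dev P t u"
      unfolding abs_dev_def
    proof (intro integral_mono)
      fix x show "\<bar>t\<bar> - norm x \<le> \<bar>u \<bullet> x - t\<bar>"
        using Cauchy_Schwarz_ineq2[of u x] u by auto
    qed (auto intro!: integrable_norm integrable_id)
    finally show ?thesis using t by (simp add: R_def)
  qed
  have "compact ({-R..R} \<times> sphere (0::'a) 1)" by (intro compact_Times) auto
  moreover have "{-R..R} \<times> sphere (0::'a) 1 \<noteq> {}"
    using R by simp
  moreover have "continuous_on ({-R..R} \<times> sphere (0::'a) 1) (\<lambda>p. abs_dev P (fst p) (snd p))"
    by (intro continuous_intros)
  ultimately obtain p where p: "p \<in> {-R..R} \<times> sphere (0::'a) 1"
    "\<And>p'. p' \<in> {-R..R} \<times> sphere (0::'a) 1 \<Longrightarrow> abs_dev P (fst p) (snd p) \<le> abs_dev P (fst p') (snd p')"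
    using continuous_attains_inf[of "{-R..R} \<times> sphere (0::'a) 1" "\<lambda>p. abs_dev P (fst p) (snd p)"]
    by blast
  show thesis
  proof (rule that)
    show "0 < min 1 (abs_dev P (fst p) (snd p))"
      using p(1) by (auto intro!: abs_dev_pos)
  next
    fix t and u :: 'a assume u: "norm u = 1"
    show "min 1 (abs_dev P (fst p) (snd p)) \<le> abs_dev P t u"
    proof (cases "\<bar>t\<bar> \<ge> R")
      case True thus ?thesis using far[OF u] by (simp add: min.coboundedI1)
    next
      case False
      hence "t \<in> {-R..R}" by auto
      thus ?thesis using p(2)[of "(t, u)"] u by auto
    qed
  qed
qed

lemma sphere_nonempty: "sphere (0::'a) 1 \<noteq> {}"
  by (simp add: sphere_eq_empty)

lemma ratio_diff_le:
  assumes c: "c > 0" "\<And>t. c \<le> abs_dev P t u"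
  shows "\<bar>lower_dev P t u / abs_dev P t u - lower_dev P s u / abs_dev P s u\<bar> \<le> 2 / c * \<bar>t - s\<bar>"
proof -
  let ?L = "\<lambda>t. lower_dev P t u" and ?A = "\<lambda>t. abs_dev P t u"
  have pos: "?A t > 0" for t using c(2)[of t] c(1) by linarith
  have L: "\<bar>?L t - ?L s\<bar> \<le> \<bar>t - s\<bar>" using lower_dev_diff_le[of t u s u] by simp
  \<comment> \<open>In \<open>A = 2 * L - t + const\<close> the function \<open>L\<close> is increasing and 1-Lipschitz, so that the
      increments of \<open>2 * L - t\<close> lie between those of \<open>- t\<close> and \<open>t\<close>.\<close>
  have A: "\<bar>?A s - ?A t\<bar> \<le> \<bar>t - s\<bar>"
  proof -
    have "?L t - ?L s \<le> t - s" "0 \<le> ?L t - ?L s" if "s \<le> t" for s t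
      using lower_dev_diff_le[of t u s u] that unfolding lower_dev_def
      by (auto intro!: integral_mono)
    from this[of s t] this[of t s] show ?thesis unfolding abs_dev_eq by linarith
  qed
  have "?L t / ?A t - ?L s / ?A s = (?L t - ?L s) / ?A t + ?L s / ?A s * ((?A s - ?A t) / ?A t)"
    using pos[of t] pos[of s] by (simp add: field_simps)
  also have "\<bar>\<dots>\<bar> \<le> \<bar>t - s\<bar> / c + 1 * (\<bar>t - s\<bar> / c)"
  proof (intro order_trans[OF abs_triangle_ineq] add_mono)
    show "\<bar>(?L t - ?L s) / ?A t\<bar> \<le> \<bar>t - s\<bar> / c"
      unfolding abs_divide using L c pos[of t] by (intro frac_le) auto
    show "\<bar>?L s / ?A s * ((?A s - ?A t) / ?A t)\<bar> \<le> 1 * (\<bar>t - s\<bar> / c)"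
      unfolding abs_mult
    proof (intro mult_mono)
      show "\<bar>?L s / ?A s\<bar> \<le> 1"
        using pos[of s] lower_dev_nonneg[of s u] lower_dev_le_abs_dev[of s u] by simp
      show "\<bar>(?A s - ?A t) / ?A t\<bar> \<le> \<bar>t - s\<bar> / c"
        unfolding abs_divide using A c pos[of t] by (intro frac_le) auto
    qed auto
  qed
  finally show ?thesis by simp
qed

lemma bdd_below_ratio:
  "bdd_below ((\<lambda>u. lower_dev P (u \<bullet> z) u / abs_dev P (u \<bullet> z) u) ` A)"
  by (intro bdd_belowI2[of _ 0] divide_nonneg_nonneg lower_dev_nonneg
        order_trans[OF lower_dev_nonneg lower_dev_le_abs_dev])

theorem uniformly_continuous_expectile_depth:
  "uniformly_continuous_on UNIV (\<lambda>z. expectile_depth z P)"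
proof -
  obtain c where c: "c > 0" "\<And>t u. norm u = 1 \<Longrightarrow> c \<le> abs_dev P t u"
    using abs_dev_lower_bound by blast
  have le: "expectile_depth z P - 2 / c * dist z w \<le> expectile_depth w P" for z w
    unfolding expectile_depth_eq_INF[of w]
  proof (rule cINF_greatest[OF sphere_nonempty])
    fix u :: 'a assume u: "u \<in> sphere 0 1"
    have "\<bar>u \<bullet> z - u \<bullet> w\<bar> \<le> dist z w"
      using Cauchy_Schwarz_ineq2[of u "z - w"] u by (simp add: inner_diff_right dist_norm)
    hence "2 / c * \<bar>u \<bullet> z - u \<bullet> w\<bar> \<le> 2 / c * dist z w"
      using c(1) by (intro mult_left_mono) auto
    moreover have "expectile_depth z P \<le> lower_dev P (u \<bullet> z) u / abs_dev P (u \<bullet> z) u"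
      unfolding expectile_depth_eq_INF by (intro cINF_lower bdd_below_ratio u)
    ultimately show "expectile_depth z P - 2 / c * dist z w
        \<le> lower_dev P (u \<bullet> w) u / abs_dev P (u \<bullet> w) u"
      using ratio_diff_le[OF c(1) c(2)[of u], of "u \<bullet> z" "u \<bullet> w"] u by auto
  qed
  have "(2 / c)-lipschitz_on UNIV (\<lambda>z. expectile_depth z P)"
  proof (rule lipschitz_onI)
    fix z w show "dist (expectile_depth z P) (expectile_depth w P) \<le> 2 / c * dist z w"
      using le[of z w] le[of w z] by (simp add: dist_real_def dist_commute abs_le_iff)
  qed (use c in auto)
  thus ?thesis by (rule lipschitz_on_uniformly_continuous)
qed

section \<open>Directional derivatives\<close>

text \<open>
  Dominated convergence along sequences: the integrand is bounded by \<open>\<bar>u \<bullet> v\<bar>\<close>, and at \<open>h = 0\<close> it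
  can fail to converge only at points \<open>x\<close> on the limiting hyperplane \<open>u \<bullet> x = u \<bullet> z\<close>. Either this hyperplane
  is null, or \<open>u\<close> is isolated in \<open>K\<close>, so that the sequence of directions is eventually constant and \<open>x\<close>
  stays on the kink.
\<close>

lemma continuous_on_integral_neg_slope:
  assumes null: "\<And>u. u \<in> K \<Longrightarrow> \<not> u islimpt K \<or> prob {x. u \<bullet> x = u \<bullet> z} = 0"
    and K: "bounded K"
  shows "continuous_on ({0..1} \<times> K)
    (\<lambda>(h, u). \<integral>x. neg_slope h (u \<bullet> v) (u \<bullet> x - u \<bullet> z) \<partial>P)"
  unfolding continuous_on_sequentially
proof (intro allI ballI impI, elim conjE)
  fix p :: "nat \<Rightarrow> real \<times> 'a" and p0
  assume p0: "p0 \<in> {0..1} \<times> K" and p: "\<forall>n. p n \<in> {0..1} \<times> K" and lim: "p \<longlonglongrightarrow> p0"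
  obtain h0 u0 where hu0: "p0 = (h0, u0)" by (cases p0)
  define h where "h n = fst (p n)" for n
  define u where "u n = snd (p n)" for n
  have h0: "h0 \<in> {0..1}" and u0: "u0 \<in> K" using p0 hu0 by auto
  have hn: "h n \<in> {0..1}" and un: "u n \<in> K" for n
    using p by (auto simp: h_def u_def mem_Times_iff)
  have h: "h \<longlonglongrightarrow> h0" and u: "u \<longlonglongrightarrow> u0"
    using tendsto_fst[OF lim] tendsto_snd[OF lim] unfolding h_def u_def hu0 by simp_all
  obtain B where B: "\<And>u. u \<in> K \<Longrightarrow> norm u \<le> B" using K by (auto simp: bounded_iff)
  have conv: "(\<lambda>n. neg_slope (h n) (u n \<bullet> v) (u n \<bullet> x - u n \<bullet> z)) \<longlonglongrightarrow>
        neg_slope h0 (u0 \<bullet> v) (u0 \<bullet> x - u0 \<bullet> z)"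
    if "u0 \<bullet> x = u0 \<bullet> z \<Longrightarrow> \<forall>\<^sub>F n in sequentially. u n \<bullet> x = u n \<bullet> z" for x
  proof (intro tendsto_neg_slope h tendsto_intros u)
    show "\<forall>\<^sub>F n in sequentially. u n \<bullet> x - u n \<bullet> z = 0" if "u0 \<bullet> x - u0 \<bullet> z = 0"
      using \<open>u0 \<bullet> x = u0 \<bullet> z \<Longrightarrow> _\<close> that by simp
  qed (use h0 hn in auto)
  have "AE x in P. (\<lambda>n. neg_slope (h n) (u n \<bullet> v) (u n \<bullet> x - u n \<bullet> z)) \<longlonglongrightarrow>
        neg_slope h0 (u0 \<bullet> v) (u0 \<bullet> x - u0 \<bullet> z)"
  proof (cases "u0 islimpt K")
    case True
    hence "prob {x. u0 \<bullet> x = u0 \<bullet> z} = 0" using null[OF u0] by blast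
    moreover have "{x. u0 \<bullet> x = u0 \<bullet> z} \<in> events"
      by (auto simp: sets_eq intro!: borel_closed closed_hyperplane)
    ultimately have "AE x in P. x \<notin> {x. u0 \<bullet> x = u0 \<bullet> z}"
      by (subst (asm) prob_eq_0) auto
    thus ?thesis by eventually_elim (auto intro!: conv)
  next
    case False
    then obtain T where T: "u0 \<in> T" "open T" "\<And>y. y \<in> K \<Longrightarrow> y \<in> T \<Longrightarrow> y = u0"
      by (auto simp: islimpt_def)
    have "\<forall>\<^sub>F n in sequentially. u n \<in> T" 
      by (rule topological_tendstoD[OF u T(2,1)])
    hence "\<forall>\<^sub>F n in sequentially. u n = u0" by eventually_elim (use T(3) un in auto)
    hence "\<forall>\<^sub>F n in sequentially. u n \<bullet> x = u n \<bullet> z" if "u0 \<bullet> x = u0 \<bullet> z" for x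
      by eventually_elim (use that in auto)
    thus ?thesis by (intro AE_I2 conv)
  qed
  moreover have "\<bar>neg_slope (h n) (u n \<bullet> v) (u n \<bullet> x - u n \<bullet> z)\<bar> \<le> B * norm v" for n x
    using abs_neg_slope_le[of "h n" "u n \<bullet> v" "u n \<bullet> x - u n \<bullet> z"]
      Cauchy_Schwarz_ineq2[of "u n" v] mult_right_mono[OF B[OF un[of n]], of "norm v"] by auto
  ultimately have "(\<lambda>n. \<integral>x. neg_slope (h n) (u n \<bullet> v) (u n \<bullet> x - u n \<bullet> z) \<partial>P) \<longlonglongrightarrow>
        (\<integral>x. neg_slope h0 (u0 \<bullet> v) (u0 \<bullet> x - u0 \<bullet> z) \<partial>P)"
    by (intro integral_dominated_convergence[where w = "\<lambda>_. B * norm v"]) auto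
  thus "((\<lambda>(h, u). \<integral>x. neg_slope h (u \<bullet> v) (u \<bullet> x - u \<bullet> z) \<partial>P) \<circ> p) \<longlonglongrightarrow>
     (case p0 of (h, u) \<Rightarrow> \<integral>x. neg_slope h (u \<bullet> v) (u \<bullet> x - u \<bullet> z) \<partial>P)"
    by (simp add: o_def case_prod_beta h_def u_def hu0)
qed

lemma lower_dev_shift:
  "lower_dev P (u \<bullet> (z + h *\<^sub>R v)) u = lower_dev P (u \<bullet> z) u
     + h * (\<integral>x. neg_slope h (u \<bullet> v) (u \<bullet> x - u \<bullet> z) \<partial>P)"
proof -
  have int: "integrable P (\<lambda>x. neg_slope h (u \<bullet> v) (u \<bullet> x - u \<bullet> z))"
    by (intro integrable_const_bound[where B = "\<bar>u \<bullet> v\<bar>"] always_eventually)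
       (auto intro: abs_neg_slope_le)
  have "lower_dev P (u \<bullet> (z + h *\<^sub>R v)) u =
     (\<integral>x. max 0 (u \<bullet> z - u \<bullet> x) + h * neg_slope h (u \<bullet> v) (u \<bullet> x - u \<bullet> z) \<partial>P)"
    unfolding lower_dev_def
    by (intro Bochner_Integration.integral_cong refl)
       (use neg_slope_eq[of h "u \<bullet> v" "u \<bullet> _ - u \<bullet> z"] in \<open>simp add: inner_add_right algebra_simps\<close>)
  thus ?thesis using int by (simp add: lower_dev_def)
qed

theorem directional_derivative_expectile_depth:
  assumes null: "\<And>u. u \<in> sphere 0 1 \<Longrightarrow>
      \<not> u islimpt sphere 0 1 \<or> prob {x. u \<bullet> x = u \<bullet> z} = 0"
  shows "\<exists>D. has_directional_derivative (\<lambda>z. expectile_depth z P) D z v"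
proof -
  define \<mu> where "\<mu> = (\<integral>x. x \<partial>P)"
  define G where "G h u = (\<integral>x. neg_slope h (u \<bullet> v) (u \<bullet> x - u \<bullet> z) \<partial>P)" for h u
  define g where "g u = lower_dev P (u \<bullet> z) u / abs_dev P (u \<bullet> z) u" for u
  \<comment> \<open>The difference quotient of the ratio \<open>L / A\<close>: in \<open>L\<^sub>h * A\<^sub>0 - L\<^sub>0 * A\<^sub>h\<close> the products
      \<open>2 * L\<^sub>h * L\<^sub>0\<close> cancel, which leaves a multiple of \<open>h\<close>.\<close>
  define q where "q h u = (G h u * (u \<bullet> \<mu> - u \<bullet> z) + lower_dev P (u \<bullet> z) u * (u \<bullet> v)) /
     (abs_dev P (u \<bullet> (z + h *\<^sub>R v)) u * abs_dev P (u \<bullet> z) u)" for h u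
  have pos: "abs_dev P t u > 0" if "u \<in> sphere 0 1" for t u
    using that by (intro abs_dev_pos) auto
  have G: "continuous_on ({0..1} \<times> sphere 0 1) (\<lambda>p. G (fst p) (snd p))"
    using continuous_on_integral_neg_slope[OF null bounded_sphere, of v]
    by (simp add: G_def case_prod_beta)
  have "continuous_on ({0..1} \<times> sphere 0 1) (\<lambda>p. q (fst p) (snd p))"
    unfolding q_def using pos
    by (intro continuous_intros G) (auto simp: less_imp_neq[symmetric])
  hence q: "continuous_on ({0..1} \<times> sphere 0 1) (\<lambda>(h, u). q h u)"
    by (simp add: case_prod_beta)
  have g: "continuous_on (sphere 0 1) g"
    unfolding g_def using pos by (intro continuous_intros) (auto simp: less_imp_neq[symmetric])
  have eq: "lower_dev P (u \<bullet> (z + h *\<^sub>R v)) u / abs_dev P (u \<bullet> (z + h *\<^sub>R v)) u = g u + h * q h u"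
    if u: "u \<in> sphere 0 1" for h u
  proof -
    define L0 A0 Lh Ah where defs: "L0 = lower_dev P (u \<bullet> z) u" "A0 = abs_dev P (u \<bullet> z) u"
      "Lh = lower_dev P (u \<bullet> (z + h *\<^sub>R v)) u" "Ah = abs_dev P (u \<bullet> (z + h *\<^sub>R v)) u"
    have A: "A0 > 0" "Ah > 0" using pos[OF u] by (auto simp: defs)
    have A0: "A0 = 2 * L0 + (u \<bullet> \<mu> - u \<bullet> z)"
      unfolding defs abs_dev_eq \<mu>_def ..
    have Ah: "Ah = 2 * Lh + (u \<bullet> \<mu> - u \<bullet> z) - h * (u \<bullet> v)"
      unfolding defs abs_dev_eq \<mu>_def by (simp add: inner_add_right)
    have Lh: "Lh = L0 + h * G h u"
      unfolding defs G_def by (rule lower_dev_shift)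
    have "Lh * A0 = L0 * Ah + h * (G h u * (u \<bullet> \<mu> - u \<bullet> z) + L0 * (u \<bullet> v))"
      unfolding A0 Ah Lh by (simp add: algebra_simps)
    hence "Lh / Ah = L0 / A0 + h * ((G h u * (u \<bullet> \<mu> - u \<bullet> z) + L0 * (u \<bullet> v)) / (Ah * A0))"
      using A by (simp add: field_simps)
    thus ?thesis unfolding g_def q_def defs .
  qed
  obtain D where "((\<lambda>h. (expectile_depth (z + h *\<^sub>R v) P - expectile_depth (z + 0 *\<^sub>R v) P) / h)
      \<longlongrightarrow> D) (at_right 0)"
  proof (rule has_right_derivative_INF[OF compact_sphere sphere_nonempty g q])
    show "expectile_depth (z + h *\<^sub>R v) P = (INF u\<in>sphere 0 1. g u + h * q h u)" for h
      unfolding expectile_depth_eq_INF by (intro INF_cong refl eq)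
  qed
  thus ?thesis by (auto simp: has_directional_derivative_def)
qed

end

lemma expectile_classD: "P \<in> expectile_class \<Longrightarrow> expectile_measure P"
  unfolding expectile_class_def expectile_measure_def expectile_measure_axioms_def by blast

lemma finite_unit_sphere_1D:
  assumes "DIM('a::euclidean_space) = 1"
  shows "finite (sphere (0::'a) 1)"
proof -
  obtain e :: 'a where e: "Basis = {e}" using assms by (auto simp: card_1_singleton_iff)
  have "u \<in> {e, -e}" if "norm u = 1" for u :: 'a
  proof -
    have u: "u = (u \<bullet> e) *\<^sub>R e" using euclidean_representation[of u] unfolding e by simp
    have "e \<in> Basis" by (simp add: e)
    hence "norm e = 1" by (rule norm_Basis)
    hence "\<bar>u \<bullet> e\<bar> = 1" using that u by (metis mult.right_neutral norm_scaleR)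
    thus ?thesis using u by (cases "u \<bullet> e \<ge> 0") auto
  qed
  hence "sphere 0 1 \<subseteq> {e, -e}" by (intro subsetI) (metis mem_sphere_0)
  thus ?thesis using finite_subset by blast
qed

lemma has_directional_derivative_imp_at_right:
  assumes "has_directional_derivative f D (t *\<^sub>R e) e"
  shows "((\<lambda>s. f (s *\<^sub>R e)) has_real_derivative D) (at_right t)"
proof -
  have "((\<lambda>h. (f ((t + h) *\<^sub>R e) - f (t *\<^sub>R e)) / h) \<longlongrightarrow> D) (at_right 0)"
    using assms by (simp add: has_directional_derivative_def scaleR_left_distrib)
  thus ?thesis
    unfolding has_field_derivative_iff filterlim_at_right_to_0[of _ _ t]
    by (simp add: add.commute)
qed

lemma has_directional_derivative_imp_at_left:
  assumes "has_directional_derivative f D (t *\<^sub>R e) (- e)"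
  shows "((\<lambda>s. f (s *\<^sub>R e)) has_real_derivative - D) (at_left t)"
proof -
  have "((\<lambda>s. f (s *\<^sub>R (- e))) has_real_derivative D) (at_right (- t))"
    using assms by (intro has_directional_derivative_imp_at_right) simp
  hence "((\<lambda>s. (f (- s *\<^sub>R e) - f (t *\<^sub>R e)) / (s + t)) \<longlongrightarrow> D) (at_right (- t))"
    by (simp add: has_field_derivative_iff)
  hence "((\<lambda>s. - ((f (- s *\<^sub>R e) - f (t *\<^sub>R e)) / (s + t))) \<longlongrightarrow> - D) (at_right (- t))"
    by (rule tendsto_minus)
  moreover have "- (a / (s + t)) = a / (- s - t)" for a s :: real
    by (metis minus_add_distrib minus_divide_right uminus_add_conv_diff add.commute)
  ultimately show ?thesis
    unfolding has_field_derivative_iff filterlim_at_left_to_right by simp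
qed

theorem theorem5p3:
  fixes P :: "'a::euclidean_space measure"
  assumes "P \<in> expectile_class"
  shows "uniformly_continuous_on UNIV (\<lambda>z. expectile_depth z P)
    \<and> (DIM('a) = 1 \<longrightarrow>
        (\<forall>e\<in>Basis. \<forall>t::real.
          (\<exists>D. ((\<lambda>s. expectile_depth (s *\<^sub>R e) P) has_real_derivative D) (at_left t)) \<and>
          (\<exists>D. ((\<lambda>s. expectile_depth (s *\<^sub>R e) P) has_real_derivative D) (at_right t))))
    \<and> (DIM('a) \<ge> 2 \<longrightarrow>
        (\<forall>z0 N. z0 \<in> interior N \<and> smooth_measure_on P N \<longrightarrow>
          (\<forall>v\<in>sphere 0 1. \<exists>D. has_directional_derivative (\<lambda>z. expectile_depth z P) D z0 v)))"
proof -
  interpret expectile_measure P using assms by (rule expectile_classD)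
  have dir: "\<exists>D. has_directional_derivative (\<lambda>z. expectile_depth z P) D z v"
    if "DIM('a) = 1" for z v :: 'a
    using islimpt_finite[OF finite_unit_sphere_1D[OF that]]
    by (intro directional_derivative_expectile_depth) blast
  have one: "(\<exists>D. ((\<lambda>s. expectile_depth (s *\<^sub>R e) P) has_real_derivative D) (at_left t)) \<and>
      (\<exists>D. ((\<lambda>s. expectile_depth (s *\<^sub>R e) P) has_real_derivative D) (at_right t))"
    if dim: "DIM('a) = 1" for e :: 'a and t
  proof -
    obtain D D' where "has_directional_derivative (\<lambda>z. expectile_depth z P) D (t *\<^sub>R e) (- e)"
      "has_directional_derivative (\<lambda>z. expectile_depth z P) D' (t *\<^sub>R e) e"
      using dir[OF dim] by metis
    from has_directional_derivative_imp_at_left[OF this(1)]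
      has_directional_derivative_imp_at_right[OF this(2)]
    show ?thesis by blast
  qed
  have two: "\<exists>D. has_directional_derivative (\<lambda>z. expectile_depth z P) D z0 v"
    if "z0 \<in> interior N" "smooth_measure_on P N" for z0 v :: 'a and N
  proof (rule directional_derivative_expectile_depth)
    fix u :: 'a assume u: "u \<in> sphere 0 1"
    have "hyperplane {x. u \<bullet> x = u \<bullet> z0}" 
      unfolding hyperplane_def using u by (intro exI[of _ u] exI[of _ "u \<bullet> z0"]) auto
    thus "\<not> u islimpt sphere 0 1 \<or> prob {x. u \<bullet> x = u \<bullet> z0} = 0"
      using that interior_subset unfolding smooth_measure_on_def by blast
  qed
  show ?thesis
    using uniformly_continuous_expectile_depth one two by blast
qed

end
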